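(* Let $\mathcal{A}$ be a faithful Banach algebra and let $\varphi\in\Delta(\mathcal{A})$. Suppose that there is a topologically left invariant $\varphi$-mean of norm one on $\mathcal{A}^*$ and that $\overline{\langle \mathcal{A}\cdot I_{\varphi}\rangle}= I_{\varphi}$. Then $i^{**}(\mathrm{TLIM}_{\varphi}(\mathcal{A}^{**}))\subseteq \mathrm{TLIM}_{\varphi}(\mathcal{A}_M^{**})$. Furthermore, the map $i^{**}:\mathrm{TLIM}_{\varphi}(\mathcal{A}^{**})\rightarrow \mathrm{TLIM}_{\varphi}(\mathcal{A}_M^{**})$ is a bijection.
   Context: A Banach algebra $\mathcal{A}$ is faithful if for each $a\in\mathcal{A}\setminus\{0\}$ there are $b,c\in\mathcal{A}$ with $ab\neq 0$ and $ca\neq 0$. The multiplier norm on a faithful $\mathcal{A}$ is $\|a\|_M=\sup\{\|ab\|,\|ba\| : b\in\mathcal{A},\ \|b\|\le 1\}$, and $\mathcal{A}_M$ denotes the completion of $\mathcal{A}$ with respect to $\|\cdot\|_M$; it is a Banach algebra containing $\mathcal{A}$ as a dense two-sided ideal. Let $i:\mathcal{A}\to\mathcal{A}_M$ be the inclusion, with adjoint $i^*:\mathcal{A}_M^*\to\mathcal{A}^*$ (restriction) and second adjoint $i^{**}:\mathcal{A}^{**}\to\mathcal{A}_M^{**}$. $\Delta(\mathcal{A})$ is the set of characters (non-zero multiplicative linear functionals) of $\mathcal{A}$; every $\varphi\in\Delta(\mathcal{A})$ extends uniquely by continuity to a character of $\mathcal{A}_M$, again denoted $\varphi$, and in this way $\Delta(\mathcal{A})=\Delta(\mathcal{A}_M)$.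 $I_\varphi=\{a\in\mathcal{A}:\varphi(a)=0\}$, and $\overline{\langle\mathcal{A}\cdot I_\varphi\rangle}$ is the closed linear span in $\mathcal{A}$ of $\{ab:a\in\mathcal{A},b\in I_\varphi\}$. For a Banach algebra $\mathcal{B}$, $f\in\mathcal{B}^*$, $a,b\in\mathcal{B}$ put $\langle f\cdot a,b\rangle=\langle f,ab\rangle$. For $\varphi\in\Delta(\mathcal{B})$ and a closed subspace $X\subseteq\mathcal{B}^*$ containing $\varphi$ with $X\cdot\mathcal{B}\subseteq X$, a topologically left invariant $\varphi$-mean on $X$ is an $m\in X^*$ with $m(\varphi)=1$ and $\langle m,f\cdot a\rangle=\varphi(a)\langle m,f\rangle$ for all $f\in X$, $a\in\mathcal{B}$. $\mathrm{TLIM}_\varphi(X^* )$ is the set of those with $\|m\|=1$; the case $X=\mathcal{B}^*$ gives $\mathrm{TLIM}_\varphi(\mathcal{B}^{**})$. This is used with $\mathcal{B}=\mathcal{A}$ and with $\mathcal{B}=\mathcal{A}_M$. *)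

theory Defs
  imports "HOL-Analysis.Analysis"
begin

section \<open>Complex normed spaces and complex Banach algebras\<close>

class scaleC =
  fixes scaleC :: "complex \<Rightarrow> 'a \<Rightarrow> 'a"  (infixr "*\<^sub>C" 75)

class complex_normed_vector = real_normed_vector + scaleC +
  assumes scaleC_add_right: "c *\<^sub>C (x + y) = c *\<^sub>C x + c *\<^sub>C y"
    and scaleC_add_left: "(c + d) *\<^sub>C x = c *\<^sub>C x + d *\<^sub>C x"
    and scaleC_scaleC: "c *\<^sub>C d *\<^sub>C x = (c * d) *\<^sub>C x"
    and scaleC_of_real: "complex_of_real r *\<^sub>C x = r *\<^sub>R x"
    and norm_scaleC: "norm (c *\<^sub>C x) = cmod c * norm x"

text \<open>As in \<^class>\<open>real_normed_algebra\<close>, no unit is required.\<close>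

class complex_banach_algebra = complex_normed_vector + real_normed_algebra + banach +
  assumes mult_scaleC_left: "(c *\<^sub>C x) * y = c *\<^sub>C (x * y)"
    and mult_scaleC_right: "x * (c *\<^sub>C y) = c *\<^sub>C (x * y)"

class faithful_banach_algebra = complex_banach_algebra +
  assumes faithful: "a \<noteq> 0 \<Longrightarrow> \<exists>b c. a * b \<noteq> 0 \<and> c * a \<noteq> 0"

lemma scaleC_one: "1 *\<^sub>C x = (x :: 'a::complex_normed_vector)"
  using scaleC_of_real[of 1 x] by simp

global_interpretation complex_vector:
  vector_space "scaleC :: complex \<Rightarrow> 'a \<Rightarrow> 'a::complex_normed_vector"
  by unfold_locales (simp_all add: scaleC_add_right scaleC_add_left scaleC_scaleC scaleC_one)

instantiation complex :: complex_banach_algebra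
begin

definition scaleC_complex :: "complex \<Rightarrow> complex \<Rightarrow> complex"
  where "scaleC_complex c x = c * x"

instance
  by standard (simp_all add: scaleC_complex_def algebra_simps norm_mult scaleR_conv_of_real)

end

definition bounded_clinear :: "('a::complex_normed_vector \<Rightarrow> 'b::complex_normed_vector) \<Rightarrow> bool"
  where "bounded_clinear T \<longleftrightarrow> bounded_linear T \<and> (\<forall>c x. T (c *\<^sub>C x) = c *\<^sub>C T x)"


section \<open>The dual space\<close>

text \<open>The type \<open>'a cdual\<close> is the space of bounded complex-linear functionals, with the operator
  norm inherited from the space of bounded real-linear maps; the second dual of \<open>'a\<close> is
  \<open>'a cdual cdual\<close>.\<close>

typedef (overloaded) 'a cdual =
  "{f :: 'a::complex_normed_vector \<Rightarrow>\<^sub>L complex. bounded_clinear (blinfun_apply f)}"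
  morphisms blinfun_of_cdual cdual_of_blinfun
  by (rule exI[of _ 0]) (simp add: bounded_clinear_def scaleC_complex_def blinfun.bounded_linear_right)

setup_lifting type_definition_cdual

instantiation cdual :: (complex_normed_vector) complex_normed_vector
begin

lift_definition zero_cdual :: "'a cdual" is 0
  by (simp add: bounded_clinear_def scaleC_complex_def blinfun.bounded_linear_right)

lift_definition plus_cdual :: "'a cdual \<Rightarrow> 'a cdual \<Rightarrow> 'a cdual" is "(+)"
  by (auto simp: bounded_clinear_def scaleC_complex_def plus_blinfun.rep_eq algebra_simps
      intro: bounded_linear_add)

lift_definition minus_cdual :: "'a cdual \<Rightarrow> 'a cdual \<Rightarrow> 'a cdual" is "(-)"
  by (auto simp: bounded_clinear_def scaleC_complex_def minus_blinfun.rep_eq algebra_simps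
      intro: bounded_linear_sub)

lift_definition uminus_cdual :: "'a cdual \<Rightarrow> 'a cdual" is "uminus"
  by (auto simp: bounded_clinear_def scaleC_complex_def uminus_blinfun.rep_eq
      intro: bounded_linear_minus)

lift_definition scaleR_cdual :: "real \<Rightarrow> 'a cdual \<Rightarrow> 'a cdual" is "scaleR"
  by (auto simp: bounded_clinear_def scaleC_complex_def scaleR_blinfun.rep_eq
      intro: bounded_linear_const_scaleR)

lift_definition scaleC_cdual :: "complex \<Rightarrow> 'a cdual \<Rightarrow> 'a cdual"
  is "\<lambda>c f. Blinfun (\<lambda>x. c * blinfun_apply f x)"
proof -
  fix c and f :: "'a \<Rightarrow>\<^sub>L complex"
  assume f: "bounded_clinear (blinfun_apply f)"
  have "bounded_linear (\<lambda>x. c * blinfun_apply f x)"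
    by (rule bounded_linear_const_mult) (rule blinfun.bounded_linear_right)
  with f show "bounded_clinear (blinfun_apply (Blinfun (\<lambda>x. c * blinfun_apply f x)))"
    by (simp add: bounded_clinear_def scaleC_complex_def bounded_linear_Blinfun_apply)
qed

lift_definition norm_cdual :: "'a cdual \<Rightarrow> real" is norm .

definition dist_cdual :: "'a cdual \<Rightarrow> 'a cdual \<Rightarrow> real"
  where "dist_cdual f g = norm (f - g)"

definition sgn_cdual :: "'a cdual \<Rightarrow> 'a cdual"
  where "sgn_cdual f = inverse (norm f) *\<^sub>R f"

definition uniformity_cdual :: "('a cdual \<times> 'a cdual) filter"
  where "uniformity_cdual = (INF e\<in>{0<..}. principal {(f, g). dist f g < e})"

definition open_cdual :: "'a cdual set \<Rightarrow> bool"
  where "open_cdual U \<longleftrightarrow> (\<forall>f\<in>U. eventually (\<lambda>(f', g). f' = f \<longrightarrow> g \<in> U) uniformity)"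

instance
proof
  note ap = bounded_linear_Blinfun_apply bounded_linear_add bounded_linear_const_mult
    blinfun.bounded_linear_right plus_blinfun.rep_eq scaleR_blinfun.rep_eq
  fix f g h :: "'a cdual" and r s :: real and c d :: complex
  show "f + g + h = f + (g + h)" "f + g = g + f" "0 + f = f" "- f + f = 0" "f - g = f + - g"
    by (transfer; simp)+
  show "r *\<^sub>R (f + g) = r *\<^sub>R f + r *\<^sub>R g" "(r + s) *\<^sub>R f = r *\<^sub>R f + s *\<^sub>R f"
    "r *\<^sub>R s *\<^sub>R f = (r * s) *\<^sub>R f" "1 *\<^sub>R f = f"
    by (transfer; simp add: algebra_simps)+
  show "dist f g = norm (f - g)" by (rule dist_cdual_def)
  show "sgn f = inverse (norm f) *\<^sub>R f" by (rule sgn_cdual_def)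
  show "uniformity = (INF e\<in>{0<..}. principal {(f :: 'a cdual, g). dist f g < e})"
    by (rule uniformity_cdual_def)
  show "open U \<longleftrightarrow> (\<forall>f\<in>U. eventually (\<lambda>(f', g). f' = f \<longrightarrow> g \<in> U) uniformity)"
    for U :: "'a cdual set" by (rule open_cdual_def)
  show "norm f = 0 \<longleftrightarrow> f = 0" "norm (r *\<^sub>R f) = \<bar>r\<bar> * norm f"
    by (transfer; simp)+
  show "norm (f + g) \<le> norm f + norm g" by transfer (rule norm_triangle_ineq)
  show "c *\<^sub>C (f + g) = c *\<^sub>C f + c *\<^sub>C g"
    by (transfer, rule blinfun_eqI) (simp add: ap distrib_left)
  show "(c + d) *\<^sub>C f = c *\<^sub>C f + d *\<^sub>C f"
    by (transfer, rule blinfun_eqI) (simp add: ap distrib_right)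
  show "c *\<^sub>C d *\<^sub>C f = (c * d) *\<^sub>C f"
    by (transfer, rule blinfun_eqI) (simp add: ap mult.assoc)
  show "complex_of_real r *\<^sub>C f = r *\<^sub>R f"
    by (transfer, rule blinfun_eqI) (simp add: ap scaleR_conv_of_real)
  show "norm (c *\<^sub>C f) = cmod c * norm f"
  proof transfer
    fix c and f :: "'a \<Rightarrow>\<^sub>L complex"
    have le: "norm (Blinfun (\<lambda>x. c * blinfun_apply f x)) \<le> cmod c * norm f" for c f
    proof (rule norm_blinfun_bound)
      fix x
      have "cmod c * cmod (blinfun_apply f x) \<le> cmod c * (norm f * norm x)"
        by (intro mult_left_mono norm_blinfun) simp
      then show "norm (blinfun_apply (Blinfun (\<lambda>x. c * blinfun_apply f x)) x)
          \<le> cmod c * norm f * norm x"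
        by (simp add: ap norm_mult mult.assoc)
    qed simp
    show "norm (Blinfun (\<lambda>x. c * blinfun_apply f x)) = cmod c * norm f"
    proof (cases "c = 0")
      case False
      have "Blinfun (\<lambda>x. inverse c * blinfun_apply (Blinfun (\<lambda>x. c * blinfun_apply f x)) x) = f"
        by (rule blinfun_eqI) (simp add: ap False)
      with le[of "inverse c" "Blinfun (\<lambda>x. c * blinfun_apply f x)"] False
      have "cmod c * norm f \<le> norm (Blinfun (\<lambda>x. c * blinfun_apply f x))"
        by (simp add: norm_divide field_simps)
      with le[of c f] show ?thesis by simp
    qed (use le[of c f] in simp)
  qed
qed

end

lift_definition cdual_apply :: "'a::complex_normed_vector cdual \<Rightarrow> 'a \<Rightarrow> complex"
  is blinfun_apply .

text \<open>Conversely, a functional given as a function; only meaningful if it is bounded and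
  complex-linear.\<close>

definition Cdual :: "('a::complex_normed_vector \<Rightarrow> complex) \<Rightarrow> 'a cdual"
  where "Cdual g = cdual_of_blinfun (Blinfun g)"

lemma cdual_apply_Cdual: "bounded_clinear g \<Longrightarrow> cdual_apply (Cdual g) = g"
  by (simp add: Cdual_def cdual_apply.rep_eq cdual_of_blinfun_inverse
      bounded_clinear_def bounded_linear_Blinfun_apply)

lemma cdual_eqI: "(\<And>x. cdual_apply f x = cdual_apply g x) \<Longrightarrow> f = g"
  by transfer (rule blinfun_eqI)

lemma bounded_clinear_cdual_apply: "bounded_clinear (cdual_apply f)"
  by transfer simp

lemma norm_cdual_apply: "norm (cdual_apply f x) \<le> norm f * norm x"
  by transfer (rule norm_blinfun)

lemma norm_cdual_bound:
  "0 \<le> b \<Longrightarrow> (\<And>x. cmod (cdual_apply f x) \<le> b * norm x) \<Longrightarrow> norm f \<le> b"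
  by transfer (rule norm_blinfun_bound)

lemma norm_cdual_eq: "norm f = (SUP x. cmod (cdual_apply f x) / norm x)"
  by transfer (simp add: norm_blinfun.rep_eq onorm_def)

lemma bounded_clinear_compose:
  assumes "bounded_clinear S" "bounded_clinear T"
  shows "bounded_clinear (\<lambda>x. S (T x))"
  using assms by (simp add: bounded_clinear_def bounded_linear_compose)

definition dual_map ::
    "('a::complex_normed_vector \<Rightarrow> 'b::complex_normed_vector) \<Rightarrow> 'b cdual \<Rightarrow> 'a cdual"
  where "dual_map T f = Cdual (\<lambda>x. cdual_apply f (T x))"

lemma cdual_apply_dual_map:
  "bounded_clinear T \<Longrightarrow> cdual_apply (dual_map T f) x = cdual_apply f (T x)"
  by (simp add: dual_map_def cdual_apply_Cdual bounded_clinear_compose bounded_clinear_cdual_apply)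

lemma bounded_clinear_dual_map:
  fixes T :: "'a::complex_normed_vector \<Rightarrow> 'b::complex_normed_vector"
  assumes T: "bounded_clinear T"
  shows "bounded_clinear (dual_map T)"
proof -
  have add: "cdual_apply (f + g) x = cdual_apply f x + cdual_apply g x"
    for f g :: "'c::complex_normed_vector cdual" and x
    by transfer (simp add: plus_blinfun.rep_eq)
  have scR: "cdual_apply (r *\<^sub>R f) x = r *\<^sub>R cdual_apply f x"
    for f :: "'c::complex_normed_vector cdual" and x r
    by transfer (simp add: scaleR_blinfun.rep_eq)
  have scC: "cdual_apply (c *\<^sub>C f) x = c * cdual_apply f x"
    for f :: "'c::complex_normed_vector cdual" and x c
    by transfer
      (simp add: bounded_linear_Blinfun_apply bounded_linear_const_mult blinfun.bounded_linear_right)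
  obtain K where K: "\<And>x. norm (T x) \<le> norm x * K" "K \<ge> 0"
    using T bounded_linear.nonneg_bounded unfolding bounded_clinear_def by blast
  have "norm (dual_map T f) \<le> norm f * K" for f
  proof -
    have "cmod (cdual_apply (dual_map T f) x) \<le> norm f * K * norm x" for x
    proof -
      have "cmod (cdual_apply f (T x)) \<le> norm f * norm (T x)" by (rule norm_cdual_apply)
      also have "\<dots> \<le> norm f * (norm x * K)" by (intro mult_left_mono K) simp
      finally show ?thesis by (simp add: cdual_apply_dual_map T ac_simps)
    qed
    moreover have "norm f * K \<ge> 0" using K by simp
    ultimately show ?thesis by (intro norm_cdual_bound)
  qed
  then have "bounded_linear (dual_map T)"
    by (intro bounded_linear_intro[where K = K])
      (auto intro!: cdual_eqI simp: cdual_apply_dual_map T add scR)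
  then show ?thesis
    by (auto simp: bounded_clinear_def cdual_apply_dual_map[OF T] scC intro!: cdual_eqI)
qed


section \<open>Characters and topologically left invariant means\<close>

definition is_character :: "('a::complex_banach_algebra \<Rightarrow> complex) \<Rightarrow> bool"
  where "is_character f \<longleftrightarrow>
    (\<forall>x y. f (x + y) = f x + f y) \<and> (\<forall>c x. f (c *\<^sub>C x) = c * f x) \<and>
    (\<forall>x y. f (x * y) = f x * f y) \<and> (\<exists>x. f x \<noteq> 0)"

text \<open>Characters are automatically continuous (lemma \<open>is_character_unique_cdual\<close> below), so
  nothing is lost by taking them to be elements of the dual.\<close>

definition characters :: "'a::complex_banach_algebra cdual set"
  where "characters = {\<phi>. is_character (cdual_apply \<phi>)}"

definition char_ideal :: "'a::complex_banach_algebra cdual \<Rightarrow> 'a set"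
  where "char_ideal \<phi> = {a. cdual_apply \<phi> a = 0}"

definition dual_act :: "'a::complex_banach_algebra cdual \<Rightarrow> 'a \<Rightarrow> 'a cdual"  (infixl "\<cdot>" 70)
  where "f \<cdot> a = Cdual (\<lambda>b. cdual_apply f (a * b))"

definition is_TLI_mean ::
    "'a::complex_banach_algebra cdual \<Rightarrow> 'a cdual cdual \<Rightarrow> bool"
  where "is_TLI_mean \<phi> m \<longleftrightarrow> cdual_apply m \<phi> = 1 \<and>
    (\<forall>f a. cdual_apply m (f \<cdot> a) = cdual_apply \<phi> a * cdual_apply m f)"

definition TLIM :: "'a::complex_banach_algebra cdual \<Rightarrow> 'a cdual cdual set"
  where "TLIM \<phi> = {m. is_TLI_mean \<phi> m \<and> norm m = 1}"

lemma cdual_apply_dual_act: "cdual_apply (f \<cdot> a) b = cdual_apply f (a * b)"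
proof -
  have "bounded_clinear (\<lambda>b. a * b)"
    by (simp add: bounded_clinear_def bounded_linear_mult_right mult_scaleC_right)
  then show ?thesis
    by (simp add: dual_act_def cdual_apply_Cdual bounded_clinear_compose
        bounded_clinear_cdual_apply)
qed

lemma is_character_norm_le:
  fixes f :: "'a::complex_banach_algebra \<Rightarrow> complex"
  assumes "is_character f"
  shows "cmod (f a) \<le> norm a"
proof (rule ccontr)
  assume "\<not> cmod (f a) \<le> norm a"
  then have lt: "norm a < cmod (f a)" by simp
  then have fa: "f a \<noteq> 0" by auto
  have add: "f (x + y) = f x + f y" and mult: "f (x * y) = f x * f y"
    and sc: "f (c *\<^sub>C x) = c * f x" for x y c
    using assms by (auto simp: is_character_def)
  define x where "x = inverse (f a) *\<^sub>C a"
  have fx: "f x = 1" using fa by (simp add: x_def sc)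
  have nx: "norm x < 1"
    using lt fa by (simp add: x_def norm_scaleC norm_inverse norm_divide divide_simps)
  define p where "p = (\<lambda>n. ((*) x ^^ n) x)"
  have pS: "p (Suc n) = x * p n" for n by (simp add: p_def)
  have pn: "norm (p n) \<le> norm x ^ Suc n" for n
  proof (induction n)
    case (Suc n)
    have "norm (p (Suc n)) \<le> norm x * norm (p n)" unfolding pS by (rule norm_mult_ineq)
    also have "\<dots> \<le> norm x * norm x ^ Suc n" by (intro mult_left_mono Suc) simp
    finally show ?case by simp
  qed (simp add: p_def)
  have "summable (\<lambda>n. norm x ^ Suc n)"
    using nx by (simp add: summable_mult summable_geometric)
  then have "summable p" by (rule summable_comparison_test'[where N = 0]) (rule pn)
  then have "suminf p = p 0 + (\<Sum>n. x * p n)"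
    using suminf_split_head[of p] by (simp add: pS)
  also have "(\<Sum>n. x * p n) = x * suminf p"
    using bounded_linear.suminf[OF bounded_linear_mult_right \<open>summable p\<close>] by simp
  finally have "f (suminf p) = f x + f x * f (suminf p)"
    by (metis add mult p_def funpow_0)
  then show False by (simp add: fx)
qed

lemma is_character_unique_cdual:
  assumes "is_character f"
  shows "\<exists>!\<phi>. \<phi> \<in> characters \<and> cdual_apply \<phi> = f"
proof -
  have "bounded_linear f"
    using assms is_character_norm_le[OF assms] scaleC_of_real
    by (intro bounded_linear_intro[where K = 1])
      (auto simp: is_character_def scaleR_conv_of_real simp flip: scaleC_of_real)
  then have "bounded_clinear f"
    using assms by (simp add: is_character_def bounded_clinear_def scaleC_complex_def)
  then show ?thesis
    using assms by (auto simp: characters_def cdual_apply_Cdual intro!: cdual_eqI exI[of _ "Cdual f"])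
qed


section \<open>The multiplier norm and the multiplier completion\<close>

definition multiplier_norm :: "'a::complex_banach_algebra \<Rightarrow> real"
  where "multiplier_norm a =
    Sup ({norm (a * b) |b. norm b \<le> 1} \<union> {norm (b * a) |b. norm b \<le> 1})"

text \<open>The completion is described as usual by the inclusion \<open>i\<close>: an isometric (with respect to the
  multiplier norm) algebra homomorphism with dense range into a complete normed algebra. This
  determines it up to isometric isomorphism over the given algebra.\<close>

definition is_multiplier_completion ::
    "('a::faithful_banach_algebra \<Rightarrow> 'b::complex_banach_algebra) \<Rightarrow> bool"
  where "is_multiplier_completion i \<longleftrightarrow>
    (\<forall>x y. i (x + y) = i x + i y) \<and> (\<forall>c x. i (c *\<^sub>C x) = c *\<^sub>C i x) \<and>
    (\<forall>x y. i (x * y) = i x * i y) \<and> (\<forall>x. norm (i x) = multiplier_norm x) \<and>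
    closure (range i) = UNIV"

text \<open>The unique character of the completion that extends \<open>\<phi>\<close> (lemma \<open>ex1_char_extension\<close> below).\<close>

definition char_extension ::
    "('a::faithful_banach_algebra \<Rightarrow> 'b::complex_banach_algebra) \<Rightarrow> 'a cdual \<Rightarrow> 'b cdual"
  where "char_extension i \<phi> =
    (THE \<psi>. \<psi> \<in> characters \<and> (\<forall>a. cdual_apply \<psi> (i a) = cdual_apply \<phi> a))"

lemma multiplier_norm_bounds:
  fixes a :: "'a::complex_banach_algebra"
  shows multiplier_norm_le: "multiplier_norm a \<le> norm a"
    and norm_mult_le_multiplier_norm: "norm b \<le> 1 \<Longrightarrow> norm (a * b) \<le> multiplier_norm a"
proof -
  let ?S = "{norm (a * b) |b. norm b \<le> 1} \<union> {norm (b * a) |b. norm b \<le> 1}"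
  have "norm (a * b) \<le> norm a \<and> norm (b * a) \<le> norm a" if "norm b \<le> 1" for b
    using norm_mult_ineq[of a b] norm_mult_ineq[of b a] that
      mult_left_le[of "norm b" "norm a"] by (simp add: mult.commute)
  then have le: "x \<le> norm a" if "x \<in> ?S" for x using that by auto
  then have bdd: "bdd_above ?S" by (rule bdd_aboveI)
  have "norm (a * 0) \<in> ?S" by (metis (mono_tags, lifting) CollectI UnI1 norm_zero zero_le_one)
  then show "multiplier_norm a \<le> norm a"
    unfolding multiplier_norm_def by (intro cSup_least le) auto
  show "norm b \<le> 1 \<Longrightarrow> norm (a * b) \<le> multiplier_norm a"
    unfolding multiplier_norm_def by (rule cSup_upper[OF _ bdd]) auto
qed

lemma bounded_clinear_multiplier_completion:
  assumes "is_multiplier_completion i"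
  shows "bounded_clinear i"
proof -
  have "bounded_linear i"
    using assms multiplier_norm_le
    by (intro bounded_linear_intro[where K = 1])
      (auto simp: is_multiplier_completion_def simp flip: scaleC_of_real)
  then show ?thesis using assms by (simp add: bounded_clinear_def is_multiplier_completion_def)
qed

lemma ex1_char_extension:
  fixes i :: "'a::faithful_banach_algebra \<Rightarrow> 'b::complex_banach_algebra"
  assumes i: "is_multiplier_completion i" and \<phi>: "\<phi> \<in> characters"
  shows "\<exists>!\<psi>. \<psi> \<in> characters \<and> (\<forall>a. cdual_apply \<psi> (i a) = cdual_apply \<phi> a)"
proof -
  let ?f = "cdual_apply \<phi>"
  have i_add: "i (x + y) = i x + i y" and i_sc: "i (c *\<^sub>C x) = c *\<^sub>C i x"
    and i_mult: "i (x * y) = i x * i y" and i_norm: "norm (i x) = multiplier_norm x"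
    and dense: "closure (range i) = UNIV" for x y c
    using i by (auto simp: is_multiplier_completion_def)
  have f: "is_character ?f" using \<phi> by (simp add: characters_def)
  have f_add: "?f (x + y) = ?f x + ?f y" and f_mult: "?f (x * y) = ?f x * ?f y"
    and f_sc: "?f (c *\<^sub>C x) = c * ?f x" for x y c
    using f by (auto simp: is_character_def)
  interpret i: linear i
    using bounded_clinear_multiplier_completion[OF i]
    by (simp add: bounded_clinear_def bounded_linear.linear)
  interpret f: linear ?f
    using bounded_clinear_cdual_apply[of \<phi>] by (simp add: bounded_clinear_def bounded_linear.linear)
  have eqI: "F x = G x" if "continuous_on UNIV F" "continuous_on UNIV G"
    "\<And>a. F (i a) = G (i a)" for F G :: "'b \<Rightarrow> complex" and x
  proof -
    have "closed {x. F x = G x}" using that by (intro closed_Collect_eq) auto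
    moreover have "range i \<subseteq> {x. F x = G x}" using that by auto
    ultimately have "closure (range i) \<subseteq> {x. F x = G x}" by (rule closure_minimal[rotated])
    then show ?thesis using dense by auto
  qed
  obtain u where u: "?f u \<noteq> 0" using f by (auto simp: is_character_def)
  define v where "v = inverse (complex_of_real (norm u)) *\<^sub>C u"
  have "u \<noteq> 0" using u f.zero by auto
  then have v: "norm v \<le> 1" "?f v \<noteq> 0" using u by (simp_all add: v_def norm_scaleC norm_inverse f_sc)
  define K where "K = inverse (cmod (?f v))"
  have K: "K > 0" using v by (simp add: K_def)
  have bound: "cmod (?f a) \<le> K * norm (i a)" for a
  proof -
    have "cmod (?f a) * cmod (?f v) = cmod (?f (a * v))" by (simp add: f_mult norm_mult)
    also have "\<dots> \<le> norm (a * v)" by (rule is_character_norm_le[OF f])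
    also have "\<dots> \<le> norm (i a)" unfolding i_norm by (rule norm_mult_le_multiplier_norm) (rule v)
    finally show ?thesis using v by (simp add: K_def field_simps)
  qed
  define g0 where "g0 = (\<lambda>x. ?f (inv i x))"
  have g0: "g0 (i a) = ?f a" for a
  proof -
    have "i (inv i (i a)) = i a" by (simp add: f_inv_into_f)
    then have "i (inv i (i a) - a) = 0" by (simp add: i.diff)
    with bound[of "inv i (i a) - a"] show ?thesis by (simp add: g0_def f.diff)
  qed
  have "uniformly_continuous_on (range i) g0"
  proof (rule lipschitz_on_uniformly_continuous[where L = K], rule lipschitz_onI)
    fix x y assume "x \<in> range i" "y \<in> range i"
    then obtain a b where "x = i a" "y = i b" by auto
    then show "dist (g0 x) (g0 y) \<le> K * dist x y"
      using bound[of "a - b"] by (simp add: dist_norm g0 i.diff f.diff)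
  qed (use K in simp)
  from uniformly_continuous_on_extension_on_closure[OF this] obtain g where
    "uniformly_continuous_on (closure (range i)) g" and "\<And>x. x \<in> range i \<Longrightarrow> g0 x = g x"
    by metis
  then have g: "continuous_on UNIV g" and gi: "g (i a) = ?f a" for a
    using dense uniformly_continuous_imp_continuous g0 by (auto simp flip: g0)
  note gc = continuous_on_compose2[OF g]
  have g_sc: "g (c *\<^sub>C x) = c * g x" for c x
  proof (rule eqI[of "\<lambda>x. g (c *\<^sub>C x)" "\<lambda>x. c * g x"])
    have "bounded_linear (\<lambda>x::'b. c *\<^sub>C x)"
      by (intro bounded_linear_intro[where K = "cmod c"])
        (simp_all add: scaleC_add_right norm_scaleC mult.commute scaleC_scaleC
          flip: scaleC_of_real)
    then show "continuous_on UNIV (\<lambda>x. g (c *\<^sub>C x))"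
      by (intro gc) (auto intro: linear_continuous_on)
  qed (auto intro!: continuous_intros g simp: gi f_sc simp flip: i_sc)
  have i_g: "g (i a + y) = g (i a) + g y" for a y
    by (rule eqI[of "\<lambda>y. g (i a + y)" "\<lambda>y. g (i a) + g y"])
      (auto intro!: continuous_intros gc g simp: gi f_add simp flip: i_add)
  have g_add: "g (x + y) = g x + g y" for x y
    by (rule eqI[of "\<lambda>x. g (x + y)" "\<lambda>x. g x + g y"])
      (auto intro!: continuous_intros gc g simp: i_g)
  have i_g: "g (i a * y) = g (i a) * g y" for a y
    by (rule eqI[of "\<lambda>y. g (i a * y)" "\<lambda>y. g (i a) * g y"])
      (auto intro!: continuous_intros gc g simp: gi f_mult simp flip: i_mult)
  have g_mult: "g (x * y) = g x * g y" for x y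
    by (rule eqI[of "\<lambda>x. g (x * y)" "\<lambda>x. g x * g y"])
      (auto intro!: continuous_intros gc g simp: i_g)
  have "is_character g"
    unfolding is_character_def using g_sc g_add g_mult gi u by metis
  then obtain \<psi> where \<psi>: "\<psi> \<in> characters" "cdual_apply \<psi> = g"
    using is_character_unique_cdual by blast
  moreover have "\<psi>' = \<psi>" if "\<forall>a. cdual_apply \<psi>' (i a) = ?f a" for \<psi>'
  proof -
    have c: "continuous_on UNIV (cdual_apply h)" for h :: "'b cdual"
      using bounded_clinear_cdual_apply[of h] by (simp add: bounded_clinear_def linear_continuous_on)
    show ?thesis
      by (rule cdual_eqI, rule eqI[of "cdual_apply \<psi>'" "cdual_apply \<psi>"]) (use that \<psi> gi c in auto)
  qed
  ultimately show ?thesis using gi by (intro ex1I[of _ \<psi>]) auto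
qed

end

theory Submission
  imports Defs
begin

text \<open>Since \<open>\<parallel>a b\<parallel> \<le> \<parallel>a\<parallel> \<parallel>b\<parallel>\<^sub>M\<close>, every functional \<open>f \<cdot> a\<close> on the algebra \<open>A\<close> extends to a
  functional \<open>E f a\<close> on \<open>A\<^sub>M\<close>. A mean \<open>m\<close> on \<open>A\<^sup>*\<close> satisfies \<open>\<phi>(a) m(f) = m(f \<cdot> a) = (i\<^sup>*\<^sup>* m)(E f a)\<close>,
  so it is determined by \<open>i\<^sup>*\<^sup>* m\<close>. Conversely, given a mean \<open>n\<close> on \<open>A\<^sub>M\<^sup>*\<close>, the functional
  \<open>a \<mapsto> n(E f a)\<close> kills \<open>A I\<^sub>\<phi>\<close>, because \<open>E f (a b) = E f a \<cdot> i b\<close>; hence it kills \<open>I\<^sub>\<phi>\<close> and equals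
  \<open>m(f) \<phi>\<close> for a scalar \<open>m(f)\<close>. This \<open>m\<close> is the preimage of \<open>n\<close>, and
  \<open>\<parallel>m\<parallel> \<le> 1\<close> because a mean of norm one on \<open>A\<^sup>*\<close> forces \<open>\<parallel>\<phi>\<parallel> = 1\<close>.\<close>

section \<open>Bounded complex-linear functionals and their extension from a dense range\<close>

lemma bounded_clinearI:
  assumes "\<And>x y. T (x + y) = T x + T y" and sc: "\<And>c x. T (c *\<^sub>C x) = c *\<^sub>C T x"
    and "\<And>x. norm (T x) \<le> K * norm x"
  shows "bounded_clinear T"
proof -
  have "T (r *\<^sub>R x) = r *\<^sub>R T x" for r x
    by (metis sc scaleC_of_real)
  then have "bounded_linear T"
    using assms by (intro bounded_linear_intro[where K = K]) (simp_all add: mult.commute)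
  with sc show ?thesis by (simp add: bounded_clinear_def)
qed

lemma
  shows cdual_apply_add: "cdual_apply f (x + y) = cdual_apply f x + cdual_apply f y"
    and cdual_apply_diff: "cdual_apply f (x - y) = cdual_apply f x - cdual_apply f y"
    and cdual_apply_scaleC: "cdual_apply f (c *\<^sub>C x) = c * cdual_apply f x"
    and continuous_on_cdual_apply: "continuous_on S (cdual_apply f)"
proof -
  have f: "bounded_linear (cdual_apply f)" "\<And>c x. cdual_apply f (c *\<^sub>C x) = c *\<^sub>C cdual_apply f x"
    using bounded_clinear_cdual_apply[of f] by (auto simp: bounded_clinear_def)
  then interpret bounded_linear "cdual_apply f" by simp
  show "cdual_apply f (x + y) = cdual_apply f x + cdual_apply f y" by (rule add)
  show "cdual_apply f (x - y) = cdual_apply f x - cdual_apply f y" by (rule diff)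
  show "cdual_apply f (c *\<^sub>C x) = c * cdual_apply f x" by (simp add: f scaleC_complex_def)
  show "continuous_on S (cdual_apply f)" by (rule linear_continuous_on) (rule f)
qed

lemma plus_cdual_apply: "cdual_apply (f + g) x = cdual_apply f x + cdual_apply g x"
  by transfer (simp add: plus_blinfun.rep_eq)

lemma scaleC_cdual_apply: "cdual_apply (c *\<^sub>C f) x = c * cdual_apply f x"
  by transfer
    (simp add: bounded_linear_Blinfun_apply bounded_linear_const_mult blinfun.bounded_linear_right)

lemma dense_range_eqI:
  fixes F G :: "'b::topological_space \<Rightarrow> 'c::t2_space"
  assumes dense: "closure (range i) = UNIV"
    and "continuous_on UNIV F" "continuous_on UNIV G" "\<And>a. F (i a) = G (i a)"
  shows "F x = G x"
proof -
  have "closed {x. F x = G x}" using assms by (intro closed_Collect_eq) auto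
  moreover have "range i \<subseteq> {x. F x = G x}" using assms by auto
  ultimately have "closure (range i) \<subseteq> {x. F x = G x}" by (rule closure_minimal[rotated])
  then show ?thesis using dense by auto
qed

lemma cdual_eq_on_dense:
  assumes "closure (range i) = UNIV" "\<And>a. cdual_apply f (i a) = cdual_apply g (i a)"
  shows "f = g"
  by (rule cdual_eqI, rule dense_range_eqI[OF assms(1)])
    (use assms(2) continuous_on_cdual_apply in auto)

text \<open>The bound forces \<open>h\<close> to vanish on the kernel of \<open>i\<close> and to be
  Lipschitz for the norm of \<open>i x\<close>. So \<open>h\<close> descends to
  \<open>range i\<close> and extends by uniform continuity; linearity and the bound pass to the
  limit by density.\<close>

lemma cdual_dense_extension:
  fixes i :: "'a::complex_normed_vector \<Rightarrow> 'b::complex_normed_vector"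
  assumes i: "bounded_clinear i" and dense: "closure (range i) = UNIV"
    and K: "K \<ge> 0" and bound: "\<And>x. cmod (cdual_apply h x) \<le> K * norm (i x)"
  shows "\<exists>g. (\<forall>x. cdual_apply g (i x) = cdual_apply h x) \<and> norm g \<le> K"
proof -
  interpret i: bounded_linear i using i by (simp add: bounded_clinear_def)
  have i_sc: "i (c *\<^sub>C x) = c *\<^sub>C i x" for c x using i by (simp add: bounded_clinear_def)
  note eqI = dense_range_eqI[OF dense]
  \<comment> \<open>\<open>inv i\<close> picks some preimage; any two differ by a kernel element, on
    which \<open>h\<close> vanishes.\<close>
  define g0 where "g0 = (\<lambda>y. cdual_apply h (inv i y))"
  have g0: "g0 (i a) = cdual_apply h a" for a
  proof -
    have "i (inv i (i a) - a) = 0" by (simp add: i.diff f_inv_into_f)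
    with bound[of "inv i (i a) - a"] show ?thesis by (simp add: g0_def cdual_apply_diff)
  qed
  have "uniformly_continuous_on (range i) g0"
  proof (rule lipschitz_on_uniformly_continuous[where L = K], rule lipschitz_onI)
    fix x y assume "x \<in> range i" "y \<in> range i"
    then obtain a b where "x = i a" "y = i b" by auto
    then show "dist (g0 x) (g0 y) \<le> K * dist x y"
      using bound[of "a - b"] by (simp add: dist_norm g0 i.diff cdual_apply_diff)
  qed (rule K)
  from uniformly_continuous_on_extension_on_closure[OF this] obtain g where
    "uniformly_continuous_on (closure (range i)) g" and "\<And>x. x \<in> range i \<Longrightarrow> g0 x = g x"
    by metis
  then have g: "continuous_on UNIV g" and gi: "g (i a) = cdual_apply h a" for a
    using dense uniformly_continuous_imp_continuous g0 by (auto simp flip: g0)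
  note gc = continuous_on_compose2[OF g]
  have g_sc: "g (c *\<^sub>C x) = c *\<^sub>C g x" for c x
  proof (rule eqI[of "\<lambda>x. g (c *\<^sub>C x)" "\<lambda>x. c *\<^sub>C g x"])
    have "bounded_clinear (\<lambda>x::'b. c *\<^sub>C x)"
      by (intro bounded_clinearI[where K = "cmod c"])
        (simp_all add: scaleC_add_right norm_scaleC scaleC_scaleC mult.commute)
    then show "continuous_on UNIV (\<lambda>x. g (c *\<^sub>C x))"
      by (intro gc) (auto intro: linear_continuous_on simp: bounded_clinear_def)
    show "continuous_on UNIV (\<lambda>x. c *\<^sub>C g x)"
      by (auto intro!: continuous_intros g simp: scaleC_complex_def)
    show "g (c *\<^sub>C i a) = c *\<^sub>C g (i a)" for a
      by (simp add: gi cdual_apply_scaleC scaleC_complex_def flip: i_sc)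
  qed
  \<comment> \<open>Additivity takes two density arguments: first in \<open>y\<close> with the other
    summand in \<open>range i\<close>, then in that summand.\<close>
  have i_g: "g (i a + y) = g (i a) + g y" for a y
    by (rule eqI[of "\<lambda>y. g (i a + y)" "\<lambda>y. g (i a) + g y"])
      (auto intro!: continuous_intros gc g simp: gi cdual_apply_add simp flip: i.add)
  have g_add: "g (x + y) = g x + g y" for x y
    by (rule eqI[of "\<lambda>x. g (x + y)" "\<lambda>x. g x + g y"])
      (auto intro!: continuous_intros gc g simp: i_g)
  have "closed {x. cmod (g x) \<le> K * norm x}"
    by (intro closed_Collect_le continuous_intros g)
  moreover have "range i \<subseteq> {x. cmod (g x) \<le> K * norm x}" using bound by (auto simp: gi)
  ultimately have g_le: "cmod (g x) \<le> K * norm x" for x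
    using closure_minimal[of "range i" "{x. cmod (g x) \<le> K * norm x}"] dense by auto
  have "bounded_clinear g" by (rule bounded_clinearI[OF g_add g_sc g_le])
  with gi g_le K show ?thesis
    by (intro exI[of _ "Cdual g"]) (auto simp: cdual_apply_Cdual intro!: norm_cdual_bound)
qed

section \<open>Norm estimates for products, characters and the module action\<close>

lemma norm_mult_le_multiplier_norm_right:
  fixes a b :: "'a::complex_banach_algebra"
  shows "norm (a * b) \<le> norm a * multiplier_norm b"
proof (cases "a = 0")
  case False
  let ?S = "{norm (b * c) |c. norm c \<le> 1} \<union> {norm (c * b) |c. norm c \<le> 1}"
  have "norm (b * c) \<le> norm b \<and> norm (c * b) \<le> norm b" if "norm c \<le> 1" for c
    using norm_mult_ineq[of b c] norm_mult_ineq[of c b] that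
      mult_left_le[of "norm c" "norm b"] by (simp add: mult.commute)
  then have "x \<le> norm b" if "x \<in> ?S" for x using that by auto
  then have bdd: "bdd_above ?S" by (rule bdd_aboveI)
  \<comment> \<open>Scaling \<open>a\<close> to norm one makes \<open>norm (?c * b)\<close> one of
    the numbers whose supremum is the multiplier norm of \<open>b\<close>.\<close>
  let ?c = "inverse (norm a) *\<^sub>R a"
  have "norm ?c \<le> 1" using False by simp
  then have "norm (?c * b) \<in> ?S" by blast
  then have "norm (?c * b) \<le> multiplier_norm b"
    unfolding multiplier_norm_def by (rule cSup_upper[OF _ bdd])
  with False show ?thesis by (simp add: field_simps)
qed simp

lemma norm_character_le: "\<phi> \<in> characters \<Longrightarrow> norm \<phi> \<le> 1"
  by (rule norm_cdual_bound) (auto simp: characters_def is_character_norm_le)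

text \<open>Supplies the continuity in \<open>a\<close> that lets invariance pass from
  \<open>range i\<close> to the whole completion.\<close>

lemma bounded_linear_dual_act: "bounded_linear (\<lambda>a. f \<cdot> a)"
proof (rule bounded_linear_intro[where K = "norm f"])
  show "f \<cdot> (x + y) = f \<cdot> x + f \<cdot> y" for x y
    by (rule cdual_eqI) (simp add: cdual_apply_dual_act plus_cdual_apply distrib_right cdual_apply_add)
  show "f \<cdot> (r *\<^sub>R x) = r *\<^sub>R (f \<cdot> x)" for r x
    by (rule cdual_eqI)
      (simp add: cdual_apply_dual_act scaleC_cdual_apply cdual_apply_scaleC mult_scaleC_left
        flip: scaleC_of_real)
  show "norm (f \<cdot> a) \<le> norm a * norm f" for a
  proof (rule norm_cdual_bound)
    fix b
    have "cmod (cdual_apply f (a * b)) \<le> norm f * norm (a * b)" by (rule norm_cdual_apply)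
    also have "\<dots> \<le> norm f * (norm a * norm b)" by (intro mult_left_mono norm_mult_ineq) simp
    finally show "cmod (cdual_apply (f \<cdot> a) b) \<le> norm a * norm f * norm b"
      by (simp add: cdual_apply_dual_act ac_simps)
  qed simp
qed

text \<open>Characters are contractive, so membership in \<open>TLIM\<close> only ever requires the
  upper norm bound.\<close>

lemma norm_ge_one_of_character_eq_one:
  assumes "\<phi> \<in> characters" "cdual_apply m \<phi> = 1"
  shows "norm m \<ge> 1"
proof -
  have "1 \<le> norm m * norm \<phi>" using norm_cdual_apply[of m \<phi>] assms(2) by simp
  also have "\<dots> \<le> norm m" using norm_character_le[OF assms(1)] by (simp add: mult_left_le)
  finally show ?thesis .
qed

section \<open>The inclusion into the multiplier completion and its adjoints\<close>

context
  fixes i :: "'a::faithful_banach_algebra \<Rightarrow> 'b::complex_banach_algebra"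
  assumes i: "is_multiplier_completion i"
begin

lemma
  shows multiplier_completion_mult: "i (x * y) = i x * i y" and norm_multiplier_completion: "norm (i x) = multiplier_norm x"
    and multiplier_completion_dense: "closure (range i) = UNIV"
  using i by (auto simp: is_multiplier_completion_def)

lemma multiplier_completion_clinear: "bounded_clinear i"
  by (rule bounded_clinear_multiplier_completion[OF i])

lemma
  assumes "\<phi> \<in> characters"
  shows char_extension_in_characters: "char_extension i \<phi> \<in> characters"
    and cdual_apply_char_extension: "cdual_apply (char_extension i \<phi>) (i a) = cdual_apply \<phi> a"
  using theI'[OF ex1_char_extension[OF i assms]] by (auto simp: char_extension_def)

lemma dual_map_char_extension:
  "\<phi> \<in> characters \<Longrightarrow> dual_map i (char_extension i \<phi>) = \<phi>"
  by (rule cdual_eqI) (simp add: cdual_apply_dual_map multiplier_completion_clinear cdual_apply_char_extension)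

text \<open>Multiplicativity of \<open>i\<close> makes restriction a module map; this carries
  invariance between the two algebras.\<close>

lemma dual_map_dual_act: "dual_map i (g \<cdot> i a) = dual_map i g \<cdot> a"
  by (rule cdual_eqI)
    (simp add: cdual_apply_dual_map multiplier_completion_clinear cdual_apply_dual_act multiplier_completion_mult)

lemma cdual_apply_bidual_map:
  "cdual_apply (dual_map (dual_map i) m) g = cdual_apply m (dual_map i g)"
  by (simp add: cdual_apply_dual_map bounded_clinear_dual_map multiplier_completion_clinear)

text \<open>The multiplier norm is dominated by the original one, so \<open>i\<close> is contractive
  and so are its adjoints.\<close>

lemma norm_bidual_map_le: "norm (dual_map (dual_map i) m) \<le> norm m"
proof (rule norm_cdual_bound)
  fix g
  have "norm (dual_map i g) \<le> norm g"
  proof (rule norm_cdual_bound)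
    fix x
    have "cmod (cdual_apply g (i x)) \<le> norm g * norm (i x)" by (rule norm_cdual_apply)
    also have "\<dots> \<le> norm g * norm x"
      by (intro mult_left_mono) (simp_all add: norm_multiplier_completion multiplier_norm_le)
    finally show "cmod (cdual_apply (dual_map i g) x) \<le> norm g * norm x"
      by (simp add: cdual_apply_dual_map multiplier_completion_clinear)
  qed simp
  then have "norm m * norm (dual_map i g) \<le> norm m * norm g" by (intro mult_left_mono) simp_all
  then show "cmod (cdual_apply (dual_map (dual_map i) m) g) \<le> norm m * norm g"
    using norm_cdual_apply[of m "dual_map i g"] by (simp add: cdual_apply_bidual_map)
qed simp

text \<open>At points \<open>i a\<close> invariance reduces to that of \<open>m\<close>; both sides
  are continuous in \<open>b\<close>, so density gives the rest.\<close>

lemma bidual_map_TLIM: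
  assumes \<phi>: "\<phi> \<in> characters" and m: "m \<in> TLIM \<phi>"
  shows "dual_map (dual_map i) m \<in> TLIM (char_extension i \<phi>)"
proof -
  let ?\<psi> = "char_extension i \<phi>" and ?n = "dual_map (dual_map i) m"
  have m: "is_TLI_mean \<phi> m" "norm m = 1" using m by (auto simp: TLIM_def)
  have one: "cdual_apply ?n ?\<psi> = 1"
    using m by (simp add: cdual_apply_bidual_map dual_map_char_extension \<phi> is_TLI_mean_def)
  have "cdual_apply ?n (g \<cdot> b) = cdual_apply ?\<psi> b * cdual_apply ?n g" for g b
  proof (rule dense_range_eqI[OF multiplier_completion_dense, of "\<lambda>b. cdual_apply ?n (g \<cdot> b)"])
    show "continuous_on UNIV (\<lambda>b. cdual_apply ?n (g \<cdot> b))"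
      by (rule continuous_on_compose2[OF continuous_on_cdual_apply[of UNIV]])
        (auto intro: linear_continuous_on bounded_linear_dual_act)
    show "continuous_on UNIV (\<lambda>b. cdual_apply ?\<psi> b * cdual_apply ?n g)"
      by (intro continuous_intros continuous_on_cdual_apply)
    show "cdual_apply ?n (g \<cdot> i a) = cdual_apply ?\<psi> (i a) * cdual_apply ?n g" for a
      using m by (simp add: cdual_apply_bidual_map dual_map_dual_act cdual_apply_char_extension \<phi>
          is_TLI_mean_def)
  qed
  moreover have "norm ?n = 1"
    using norm_bidual_map_le[of m] m norm_ge_one_of_character_eq_one[OF char_extension_in_characters[OF \<phi>] one]
    by simp
  ultimately show ?thesis using one by (simp add: TLIM_def is_TLI_mean_def)
qed

section \<open>Extending \<open>f \<cdot> a\<close> to the completion, and injectivity\<close>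

lemma ex_dual_act_extension:
  "\<exists>g. dual_map i g = f \<cdot> a \<and> norm g \<le> norm f * norm a"
proof -
  have "cmod (cdual_apply (f \<cdot> a) x) \<le> norm f * norm a * norm (i x)" for x
  proof -
    have "cmod (cdual_apply f (a * x)) \<le> norm f * norm (a * x)" by (rule norm_cdual_apply)
    \<comment> \<open>Putting the multiplier norm on the factor \<open>x\<close> yields a bound by
      \<open>norm (i x)\<close>, as the extension requires.\<close>
    also have "\<dots> \<le> norm f * (norm a * multiplier_norm x)"
      by (intro mult_left_mono norm_mult_le_multiplier_norm_right) simp
    finally show ?thesis by (simp add: cdual_apply_dual_act norm_multiplier_completion ac_simps)
  qed
  from cdual_dense_extension[OF multiplier_completion_clinear multiplier_completion_dense _ this] obtain g where
    "\<forall>x. cdual_apply g (i x) = cdual_apply (f \<cdot> a) x" "norm g \<le> norm f * norm a" by auto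
  then show ?thesis
    by (intro exI[of _ g]) (auto intro!: cdual_eqI simp: cdual_apply_dual_map multiplier_completion_clinear)
qed

lemma dual_map_inject: "dual_map i g = dual_map i h \<Longrightarrow> g = h"
  by (rule cdual_eq_on_dense[OF multiplier_completion_dense]) (metis cdual_apply_dual_map multiplier_completion_clinear)

lemma inj_on_bidual_map_TLIM:
  assumes \<phi>: "\<phi> \<in> characters"
  shows "inj_on (dual_map (dual_map i)) (TLIM \<phi>)"
proof (rule inj_onI, rule cdual_eqI)
  fix m n f
  assume "m \<in> TLIM \<phi>" "n \<in> TLIM \<phi>"
    and eq: "dual_map (dual_map i) m = dual_map (dual_map i) n"
  then have mn: "cdual_apply m (f \<cdot> a) = cdual_apply \<phi> a * cdual_apply m f"
    "cdual_apply n (f \<cdot> a) = cdual_apply \<phi> a * cdual_apply n f" for a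
    by (auto simp: TLIM_def is_TLI_mean_def)
  obtain a where a: "cdual_apply \<phi> a \<noteq> 0" using \<phi> by (auto simp: characters_def is_character_def)
  obtain g where "dual_map i g = f \<cdot> a" using ex_dual_act_extension by blast
  \<comment> \<open>\<open>f \<cdot> a\<close> is a restriction from the completion, and on
    restrictions \<open>eq\<close> makes the two means agree.\<close>
  then have "cdual_apply m (f \<cdot> a) = cdual_apply n (f \<cdot> a)"
    using eq by (metis cdual_apply_bidual_map)
  with a show "cdual_apply m f = cdual_apply n f" by (simp add: mn)
qed

section \<open>Constructing a preimage of a mean on the completion\<close>

lemma bidual_map_TLIM_surj:
  assumes \<phi>: "\<phi> \<in> characters" and norm_\<phi>: "norm \<phi> = 1"
    and ideal: "closure (complex_vector.span {a * b |a b. b \<in> char_ideal \<phi>}) = char_ideal \<phi>"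
    and n: "n \<in> TLIM (char_extension i \<phi>)"
  shows "n \<in> dual_map (dual_map i) ` TLIM \<phi>"
proof -
  let ?\<psi> = "char_extension i \<phi>"
  have n1: "cdual_apply n ?\<psi> = 1" and norm_n: "norm n = 1"
    and n_act: "cdual_apply n (g \<cdot> b) = cdual_apply ?\<psi> b * cdual_apply n g" for g b
    using n by (auto simp: TLIM_def is_TLI_mean_def)
  have \<phi>_mult: "cdual_apply \<phi> (x * y) = cdual_apply \<phi> x * cdual_apply \<phi> y" for x y
    using \<phi> by (auto simp: characters_def is_character_def)
  obtain u where u: "cdual_apply \<phi> u = 1"
  proof -
    obtain v where "cdual_apply \<phi> v \<noteq> 0" using \<phi> by (auto simp: characters_def is_character_def)
    then have "cdual_apply \<phi> (inverse (cdual_apply \<phi> v) *\<^sub>C v) = 1" by (simp add: cdual_apply_scaleC)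
    with that show thesis by blast
  qed
  obtain E where E: "dual_map i (E f a) = f \<cdot> a" and norm_E: "norm (E f a) \<le> norm f * norm a" for f a
    using ex_dual_act_extension by metis
  have E_apply: "cdual_apply (E f a) (i x) = cdual_apply f (a * x)" for f a x
    using cdual_apply_dual_map[OF multiplier_completion_clinear, of "E f a" x] by (simp add: E cdual_apply_dual_act)
  \<comment> \<open>Extensions are unique by density, so every identity for \<open>E\<close>,
    including linearity in each argument, is checked on \<open>range i\<close>.\<close>
  note E_eqI = cdual_eq_on_dense[OF multiplier_completion_dense]
  note E_simps = E_apply plus_cdual_apply scaleC_cdual_apply cdual_apply_dual_act distrib_right
    mult_scaleC_left cdual_apply_add cdual_apply_scaleC mult.assoc
  define T where "T f a = cdual_apply n (E f a)" for f a
  have T_bound: "cmod (T f a) \<le> norm f * norm a" for f a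
    using norm_cdual_apply[of n "E f a"] norm_E[of f a] by (simp add: T_def norm_n)
  have "E f (x + y) = E f x + E f y" for f x y by (rule E_eqI) (simp add: E_simps)
  then have T_add: "T f (x + y) = T f x + T f y" for f x y by (simp add: T_def cdual_apply_add)
  have "E f (c *\<^sub>C x) = c *\<^sub>C E f x" for f x c by (rule E_eqI) (simp add: E_simps)
  then have T_sc: "T f (c *\<^sub>C x) = c * T f x" for f x c by (simp add: T_def cdual_apply_scaleC)
  have "E (f + g) x = E f x + E g x" for f g x by (rule E_eqI) (simp add: E_simps)
  then have T_add': "T (f + g) x = T f x + T g x" for f g x by (simp add: T_def cdual_apply_add)
  have "E (c *\<^sub>C f) x = c *\<^sub>C E f x" for f x c by (rule E_eqI) (simp add: E_simps)
  then have T_sc': "T (c *\<^sub>C f) x = c * T f x" for f x c by (simp add: T_def cdual_apply_scaleC)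
  \<comment> \<open>Both sides send \<open>i x\<close> to \<open>f (a * b * x)\<close>. Invariance
    of \<open>n\<close> then produces the factor \<open>\<phi> b\<close>, which vanishes for
    \<open>b\<close> in the ideal.\<close>
  have "E f (a * b) = E f a \<cdot> i b" for f a b
    by (rule E_eqI) (simp add: E_simps flip: multiplier_completion_mult)
  then have T_mult: "T f (a * b) = cdual_apply \<phi> b * T f a" for f a b
    by (simp add: T_def n_act cdual_apply_char_extension \<phi>)
  have T_clinear: "bounded_clinear (T f)" for f
    by (rule bounded_clinearI[where K = "norm f"])
      (simp_all add: T_add T_sc scaleC_complex_def T_bound)
  have T_ideal: "T f x = 0" if "x \<in> char_ideal \<phi>" for f x
  proof -
    have T0: "T f 0 = 0" using T_sc[of f 0 0] by simp
    have "complex_vector.span {a * b |a b. b \<in> char_ideal \<phi>} \<subseteq> {x. T f x = 0}"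
      by (rule complex_vector.span_minimal)
        (auto simp: T_mult char_ideal_def complex_vector.subspace_def T_add T_sc T0)
    moreover have "closed {x. T f x = 0}"
      using T_clinear[of f]
      by (intro closed_Collect_eq) (auto simp: bounded_clinear_def linear_continuous_on)
    ultimately show ?thesis using closure_minimal that ideal by blast
  qed
  have T_eq: "T f a = cdual_apply \<phi> a * T f u" for f a
  proof -
    \<comment> \<open>Since \<open>\<phi> u = 1\<close>, this is the component of \<open>a\<close>
      in the kernel of \<open>\<phi>\<close>; hence \<open>T f\<close> is \<open>T f u\<close> times
      \<open>\<phi>\<close>.\<close>
    let ?x = "a + (- cdual_apply \<phi> a) *\<^sub>C u"
    have "T f ?x = 0"
      by (rule T_ideal)
        (simp only: char_ideal_def mem_Collect_eq cdual_apply_add cdual_apply_scaleC u, simp)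
    then show ?thesis unfolding T_add T_sc by simp
  qed
  define m where "m = Cdual (\<lambda>f. T f u)"
  have "bounded_clinear (\<lambda>f. T f u)"
    by (rule bounded_clinearI[where K = "norm u"])
      (use T_bound in \<open>auto simp: T_add' T_sc' scaleC_complex_def mult.commute\<close>)
  then have m: "cdual_apply m f = T f u" for f by (simp add: m_def cdual_apply_Cdual)
  have "E \<phi> u = ?\<psi>"
    by (rule E_eqI) (simp add: E_apply cdual_apply_char_extension \<phi> \<phi>_mult u)
  then have m1: "cdual_apply m \<phi> = 1" by (simp add: m T_def n1)
  \<comment> \<open>Both functionals extend \<open>f \<cdot> (a * u)\<close>.\<close>
  have "E (f \<cdot> a) u = E f (a * u)" for f a
    by (rule E_eqI) (simp add: E_simps)
  then have "T (f \<cdot> a) u = T f (a * u)" for f a by (simp add: T_def)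
  then have m_act: "cdual_apply m (f \<cdot> a) = cdual_apply \<phi> a * cdual_apply m f" for f a
    using T_eq[of f "a * u"] by (simp add: m \<phi>_mult u)
  \<comment> \<open>Bounding \<open>T f u\<close> directly would cost a factor
    \<open>norm u\<close>. Instead \<open>m f\<close> times \<open>\<phi>\<close> is the whole
    functional \<open>T f\<close>, of norm at most \<open>norm f\<close>, and
    \<open>norm \<phi> = 1\<close>.\<close>
  have "cmod (cdual_apply m f) \<le> norm f" for f
  proof -
    have "norm (cdual_apply m f *\<^sub>C \<phi>) \<le> norm f"
    proof (rule norm_cdual_bound)
      show "cmod (cdual_apply (cdual_apply m f *\<^sub>C \<phi>) a) \<le> norm f * norm a" for a
        using T_bound[of f a] by (simp add: scaleC_cdual_apply m T_eq[of f a] mult.commute)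
    qed simp
    then show ?thesis by (simp add: norm_scaleC norm_\<phi>)
  qed
  then have "norm m \<le> 1" by (intro norm_cdual_bound) auto
  then have "m \<in> TLIM \<phi>"
    using norm_ge_one_of_character_eq_one[OF \<phi> m1] m1 m_act by (simp add: TLIM_def is_TLI_mean_def)
  moreover have "n = dual_map (dual_map i) m"
  proof (rule cdual_eqI)
    fix g
    \<comment> \<open>Both sides restrict to \<open>dual_map i g \<cdot> u\<close>; invariance of
      \<open>n\<close> and \<open>\<phi> u = 1\<close> then turn \<open>n (g \<cdot> i u)\<close>
      into \<open>n g\<close>.\<close>
    have "E (dual_map i g) u = g \<cdot> i u"
      by (rule dual_map_inject) (simp add: E dual_map_dual_act)
    then show "cdual_apply n g = cdual_apply (dual_map (dual_map i) m) g"
      by (simp add: cdual_apply_bidual_map m T_def n_act cdual_apply_char_extension \<phi> u)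
  qed
  ultimately show ?thesis by blast
qed

end

theorem theorem3p3:
  fixes i :: "'a::faithful_banach_algebra \<Rightarrow> 'b::complex_banach_algebra"
    and \<phi> :: "'a cdual"
  assumes "is_multiplier_completion i"
    and "\<phi> \<in> characters"
    and "\<exists>m. is_TLI_mean \<phi> m \<and> norm m = 1"
    and "closure (complex_vector.span {a * b |a b. b \<in> char_ideal \<phi>}) = char_ideal \<phi>"
  shows "dual_map (dual_map i) ` TLIM \<phi> \<subseteq> TLIM (char_extension i \<phi>) \<and>
    bij_betw (dual_map (dual_map i)) (TLIM \<phi>) (TLIM (char_extension i \<phi>))"
proof -
  obtain m where m: "cdual_apply m \<phi> = 1" "norm m = 1"
    using assms(3) by (auto simp: is_TLI_mean_def)
  \<comment> \<open>The given mean yields \<open>1 \<le> norm m * norm \<phi> = norm \<phi>\<close>;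
    contractivity of characters gives the converse.\<close>
  then have "norm \<phi> = 1"
    using norm_cdual_apply[of m \<phi>] norm_character_le[OF assms(2)] by simp
  then have "TLIM (char_extension i \<phi>) \<subseteq> dual_map (dual_map i) ` TLIM \<phi>"
    using bidual_map_TLIM_surj[OF assms(1,2) _ assms(4)] by blast
  moreover have "dual_map (dual_map i) ` TLIM \<phi> \<subseteq> TLIM (char_extension i \<phi>)"
    using bidual_map_TLIM[OF assms(1,2)] by blast
  ultimately show ?thesis
    using inj_on_bidual_map_TLIM[OF assms(1,2)] by (auto simp: bij_betw_def)
qed

end
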